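(* Let $(\mathbb{K},\partial)$ be a differential field whose field of constants $C$ is algebraically closed of characteristic zero, let $L\in\mathbb{K}[\partial]$ be of order $n$ in normal form, and let $\mathcal{G}=\{G_0=1,G_1,\ldots,G_{t-1}\}$ be a Goodearl basis of $\mathcal{C}(L)$ as a $C[L]$-module. Then the quotient ring $\mathbb{K}[\Gamma]:=\mathbb{K}[\lambda,\mu_1,\ldots,\mu_{t-1}]/[\mathrm{BC}(L)]$ is a differential integral domain.
   Context: $L=\partial^n+u_{n-2}\partial^{n-2}+\dots+u_0$. $\mathcal{C}(L)=\{A\in\mathbb{K}[\partial]:LA=AL\}$. A Goodearl basis is a $C[L]$-module basis $\{G_0=1,\ldots,G_{t-1}\}$ of $\mathcal{C}(L)$ in which each $G_k$ has minimal order among $Q\in\mathcal{C}(L)$ with $\mathrm{ord}(Q)\equiv\mathrm{ord}(G_k)\pmod n$ and the classes $\mathrm{ord}(G_k)\bmod n$ are pairwise distinct and exhaust the classes mod $n$ of orders of elements of $\mathcal{C}(L)$. $\mathrm{BC}(L)\subset C[\lambda,\mu_1,\ldots,\mu_{t-1}]$ is the kernel of the $C$-algebra map $\phi_L$: $\lambda\mapsto L$, $\mu_i\mapsto G_i$ (the Burchnall–Chaundy ideal). $\mathbb{K}[\lambda,\mu_1,\ldots,\mu_{t-1}]$ is a differential ring with derivation extending $\partial$ on coefficients and $\partial(\lambda)=\partial(\mu_i)=0$; $[\mathrm{BC}(L)]$ is the differential ideal generated by $\mathrm{BC}(L)$ in it, and the quotient carries the induced derivation. *)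

theory Defs
  imports "HOL-Computational_Algebra.Polynomial" "HOL-Library.Poly_Mapping"
begin

definition is_derivation :: "('a::field \<Rightarrow> 'a) \<Rightarrow> bool" where
  "is_derivation D \<longleftrightarrow> (\<forall>a b. D (a + b) = D a + D b \<and> D (a * b) = a * D b + D a * b)"

definition constants :: "('a::field \<Rightarrow> 'a) \<Rightarrow> 'a set" where
  "constants D = {c. D c = 0}"

definition constants_alg_closed :: "('a::field \<Rightarrow> 'a) \<Rightarrow> bool" where
  "constants_alg_closed D \<longleftrightarrow>
     (\<forall>p::'a poly. (\<forall>i. coeff p i \<in> constants D) \<and> degree p \<ge> 1 \<longrightarrow>
        (\<exists>x \<in> constants D. poly p x = 0))"

text \<open>An operator \<open>\<Sum> a_i \<partial>^i\<close> is represented by the polynomial with coefficients a_i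
  (coefficients on the left).  Addition is that of polynomials; the product uses
  the Leibniz rule \<open>\<partial>^i b = \<Sum>_k (i choose k) b^(k) \<partial>^(i-k)\<close>.  The order is the degree.\<close>

definition op_mult :: "('a::field \<Rightarrow> 'a) \<Rightarrow> 'a poly \<Rightarrow> 'a poly \<Rightarrow> 'a poly" where
  "op_mult D A B =
     (\<Sum>i\<le>degree A. \<Sum>j\<le>degree B. \<Sum>k\<le>i.
        monom (coeff A i * of_nat (i choose k) * (D ^^ k) (coeff B j)) (i - k + j))"

primrec op_pow :: "('a::field \<Rightarrow> 'a) \<Rightarrow> 'a poly \<Rightarrow> nat \<Rightarrow> 'a poly" where
  "op_pow D A 0 = 1"
| "op_pow D A (Suc m) = op_mult D A (op_pow D A m)"

abbreviation ord_op :: "'a::field poly \<Rightarrow> nat" where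
  "ord_op A \<equiv> degree A"

definition normal_form_op :: "nat \<Rightarrow> 'a::field poly \<Rightarrow> bool" where
  "normal_form_op n L \<longleftrightarrow> n \<ge> 1 \<and> degree L = n \<and> coeff L n = 1 \<and> coeff L (n - 1) = 0"

definition centralizer :: "('a::field \<Rightarrow> 'a) \<Rightarrow> 'a poly \<Rightarrow> 'a poly set" where
  "centralizer D L = {A. op_mult D L A = op_mult D A L}"

definition op_eval :: "('a::field \<Rightarrow> 'a) \<Rightarrow> 'a poly \<Rightarrow> 'a poly \<Rightarrow> 'a poly" where
  "op_eval D p L = (\<Sum>i\<le>degree p. smult (coeff p i) (op_pow D L i))"

definition const_poly :: "('a::field \<Rightarrow> 'a) \<Rightarrow> 'a poly \<Rightarrow> bool" where
  "const_poly D p \<longleftrightarrow> (\<forall>i. coeff p i \<in> constants D)"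

definition goodearl_basis ::
  "('a::field \<Rightarrow> 'a) \<Rightarrow> nat \<Rightarrow> 'a poly \<Rightarrow> nat \<Rightarrow> (nat \<Rightarrow> 'a poly) \<Rightarrow> bool" where
  "goodearl_basis D n L t G \<longleftrightarrow>
     t \<ge> 1 \<and> G 0 = 1 \<and> (\<forall>k<t. G k \<in> centralizer D L) \<and>
     \<comment> \<open>C[L]-module basis: unique representation \<open>A = \<Sum>_{i<t} p_i(L) G_i\<close>\<close>
     (\<forall>A \<in> centralizer D L. \<exists>!p. (\<forall>i. const_poly D (p i)) \<and> (\<forall>i\<ge>t. p i = 0) \<and>
          A = (\<Sum>i<t. op_mult D (op_eval D (p i) L) (G i))) \<and>
     \<comment> \<open>minimality of orders within their class mod n\<close>
     (\<forall>k<t. \<forall>Q \<in> centralizer D L. Q \<noteq> 0 \<and> ord_op Q mod n = ord_op (G k) mod n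
          \<longrightarrow> ord_op (G k) \<le> ord_op Q) \<and>
     \<comment> \<open>pairwise distinct classes mod n\<close>
     inj_on (\<lambda>k. ord_op (G k) mod n) {..<t} \<and>
     \<comment> \<open>exhausting the classes of orders of (nonzero) elements of C(L)\<close>
     (\<forall>Q \<in> centralizer D L. Q \<noteq> 0 \<longrightarrow> (\<exists>k<t. ord_op Q mod n = ord_op (G k) mod n))"

text \<open>Variable 0 is \<lambda>, variable i (1 \<le> i < t) is \<mu>_i.\<close>
type_synonym 'a mpoly = "(nat \<Rightarrow>\<^sub>0 nat) \<Rightarrow>\<^sub>0 'a"

definition polys_in :: "nat \<Rightarrow> 'a::comm_ring_1 mpoly set" where
  "polys_in t = {p. \<forall>m \<in> Poly_Mapping.keys p. \<forall>v \<in> Poly_Mapping.keys m. v < t}"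

definition mpoly_deriv :: "('a::field \<Rightarrow> 'a) \<Rightarrow> 'a mpoly \<Rightarrow> 'a mpoly" where
  "mpoly_deriv D p = Poly_Mapping.map D p"

text \<open>The substitution \<lambda> \<mapsto> L, \<mu>_i \<mapsto> G_i (the images commute, the order of the factors
  in a monomial is by increasing variable index).\<close>
definition phi_L :: "('a::field \<Rightarrow> 'a) \<Rightarrow> nat \<Rightarrow> 'a poly \<Rightarrow> (nat \<Rightarrow> 'a poly) \<Rightarrow> 'a mpoly \<Rightarrow> 'a poly" where
  "phi_L D t L G p =
     (\<Sum>m \<in> Poly_Mapping.keys p. smult (Poly_Mapping.lookup p m)
        (foldr (\<lambda>v acc. op_mult D (op_pow D (if v = 0 then L else G v) (Poly_Mapping.lookup m v)) acc)
               [0..<t] 1))"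

definition BC :: "('a::field \<Rightarrow> 'a) \<Rightarrow> nat \<Rightarrow> 'a poly \<Rightarrow> (nat \<Rightarrow> 'a poly) \<Rightarrow> 'a mpoly set" where
  "BC D t L G = {p \<in> polys_in t. (\<forall>m. Poly_Mapping.lookup p m \<in> constants D) \<and> phi_L D t L G p = 0}"

definition diff_ideal_gen :: "('a::field \<Rightarrow> 'a) \<Rightarrow> nat \<Rightarrow> 'a mpoly set \<Rightarrow> 'a mpoly set" where
  "diff_ideal_gen D t S = \<Inter>{I. S \<subseteq> I \<and> I \<subseteq> polys_in t \<and> 0 \<in> I \<and>
      (\<forall>a\<in>I. \<forall>b\<in>I. a + b \<in> I) \<and> (\<forall>a\<in>I. \<forall>r \<in> polys_in t. r * a \<in> I) \<and>
      (\<forall>a\<in>I. mpoly_deriv D a \<in> I)}"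

text \<open>The quotient (polys_in t)/I is a differential integral domain: I is a proper prime
  ideal (integral domain) and closed under the derivation (so that the derivation
  descends to the quotient).\<close>
definition quotient_diff_domain :: "('a::field \<Rightarrow> 'a) \<Rightarrow> nat \<Rightarrow> 'a mpoly set \<Rightarrow> bool" where
  "quotient_diff_domain D t I \<longleftrightarrow>
     1 \<notin> I \<and>
     (\<forall>a \<in> polys_in t. \<forall>b \<in> polys_in t. a * b \<in> I \<longrightarrow> a \<in> I \<or> b \<in> I) \<and>
     (\<forall>a \<in> I. mpoly_deriv D a \<in> I)"

end

theory Submission
  imports Defs
begin

text \<open>
  An operator commuting with \<open>L\<close> has a constant leading coefficient, so filtering by the order
  turns the commutative domain \<open>R = C[L, G_1, \<dots>, G_{t-1}]\<close> into an algebra whose graded pieces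
  are at most one-dimensional over \<open>C\<close> and whose graded product multiplies leading coefficients.
  Elements of different orders are linearly independent over \<open>K\<close>, so the \<open>K\<close>-linear extension
  of \<open>phi_L\<close> to \<open>K[\<lambda>, \<mu>]\<close> (which is not multiplicative) has as kernel exactly the \<open>K\<close>-span of
  the Burchnall--Chaundy ideal; this span is already the differential ideal, because the derivation
  kills the coefficients of its generators. The quotient is \<open>K \<otimes>_C R\<close>, filtered with the same
  graded pieces tensored with \<open>K\<close>, and leading terms show that it is a domain.

  The commutativity of the centralizer itself is an order argument: for a suitable \<open>A\<close>, every \<open>B\<close>
  in it differs from a combination of the \<open>A^q L^i\<close> by an operator of bounded order. Hence
  if \<open>X\<close> commutes with \<open>A\<close> and \<open>L\<close>, the orders of \<open>[X, L^i B] = L^i [X, B]\<close> stay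
  bounded as \<open>i\<close> grows, and \<open>[X, B] = 0\<close>.
\<close>

subsection \<open>The ring of differential operators\<close>

locale derivation =
  fixes D :: "'a::field \<Rightarrow> 'a"
  assumes D: "is_derivation D"
begin

lemma D_add [simp]: "D (a + b) = D a + D b"
  and D_mult [simp]: "D (a * b) = a * D b + D a * b"
  using D by (auto simp: is_derivation_def)

lemma D_0 [simp]: "D 0 = 0"
proof -
  have "D 0 = D 0 + D 0"
    unfolding D_add[symmetric] by simp
  then show ?thesis
    unfolding add_cancel_right_right .
qed

lemma D_1 [simp]: "D 1 = 0"
proof -
  have "D 1 = D 1 + D 1"
    using D_mult[of 1 1] unfolding mult_1 mult_1_right .
  then show ?thesis
    unfolding add_cancel_right_right .
qed

lemma D_minus [simp]: "D (- a) = - D a"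
  using D_add[of a "- a"] by (simp add: add_eq_0_iff2)

lemma D_of_nat [simp]: "D (of_nat n) = 0"
  by (induction n) auto

lemma zero_constants [simp]: "0 \<in> constants D"
  and one_constants [simp]: "1 \<in> constants D"
  and add_constants: "a \<in> constants D \<Longrightarrow> b \<in> constants D \<Longrightarrow> a + b \<in> constants D"
  and minus_constants: "a \<in> constants D \<Longrightarrow> - a \<in> constants D"
  and mult_constants: "a \<in> constants D \<Longrightarrow> b \<in> constants D \<Longrightarrow> a * b \<in> constants D"
  by (auto simp: constants_def)

lemma diff_constants: "a \<in> constants D \<Longrightarrow> b \<in> constants D \<Longrightarrow> a - b \<in> constants D"
  using add_constants[of a "- b"] minus_constants[of b] by simp

lemma inverse_constants: "inverse a \<in> constants D" if "a \<in> constants D"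
proof (cases "a = 0")
  case False
  then have "D (a * inverse a) = 0"
    by (simp del: D_mult)
  then show ?thesis
    using False that D_mult[of a "inverse a"] by (simp add: constants_def del: D_mult)
qed auto

text \<open>Left multiplication by \<open>\<partial>\<close> on operators.\<close>

definition delta :: "'a poly \<Rightarrow> 'a poly" where
  "delta B = map_poly D B + pCons 0 B"

lemma coeff_delta: "coeff (delta B) i = D (coeff B i) + coeff (pCons 0 B) i"
  by (simp add: delta_def coeff_map_poly)

lemma delta_0 [simp]: "delta 0 = 0"
  by (simp add: delta_def)

lemma delta_add: "delta (A + B) = delta A + delta B"
  by (rule poly_eqI) (simp add: coeff_delta coeff_pCons split: nat.split)

lemma delta_sum: "delta (sum f I) = (\<Sum>i\<in>I. delta (f i))"
  by (induction I rule: infinite_finite_induct) (auto simp: delta_add)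

lemma delta_smult: "delta (smult a B) = smult (D a) B + smult a (delta B)"
  by (rule poly_eqI) (simp add: coeff_delta coeff_pCons algebra_simps split: nat.split)

lemma smult_sum_right: "smult a (sum f I) = (\<Sum>i\<in>I. smult a (f i))"
  by (induction I rule: infinite_finite_induct) (auto simp: smult_add_right)

lemma delta_monom: "delta (monom c m) = monom (D c) m + monom c (Suc m)"
  by (rule poly_eqI) (simp add: coeff_delta coeff_pCons split: nat.split)

lemma funpow_delta_add: "(delta ^^ i) (A + B) = (delta ^^ i) A + (delta ^^ i) B"
  by (induction i) (auto simp: delta_add)

lemma funpow_delta_0 [simp]: "(delta ^^ i) 0 = 0"
  by (induction i) auto

lemma funpow_delta_sum: "(delta ^^ i) (sum f I) = (\<Sum>j\<in>I. (delta ^^ i) (f j))"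
  by (induction I rule: infinite_finite_induct) (auto simp: funpow_delta_add)

text \<open>The iterated Leibniz rule, by way of Pascal's rule; it ties \<open>delta\<close> to the
  binomial sum in \<open>op_mult\<close>.\<close>

lemma funpow_delta_monom:
  "(delta ^^ i) (monom b j) = (\<Sum>k\<le>i. monom (of_nat (i choose k) * (D ^^ k) b) (i - k + j))"
proof (induction i)
  case (Suc i)
  let ?f = "\<lambda>c k. monom (of_nat c * (D ^^ k) b) (Suc i - k + j)"
  have "(delta ^^ Suc i) (monom b j)
      = (\<Sum>k\<le>i. monom (of_nat (i choose k) * (D ^^ Suc k) b) (i - k + j))
      + (\<Sum>k\<le>i. monom (of_nat (i choose k) * (D ^^ k) b) (Suc (i - k + j)))"
    using Suc by (simp add: delta_sum delta_monom sum.distrib)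
  also have "(\<Sum>k\<le>i. monom (of_nat (i choose k) * (D ^^ k) b) (Suc (i - k + j)))
      = (\<Sum>k\<le>i. ?f (i choose k) k)"
    by (intro sum.cong) (auto simp: Suc_diff_le)
  also have "\<dots> = (\<Sum>k\<le>Suc i. ?f (i choose k) k)"
    by (simp add: binomial_eq_0)
  also have "\<dots> = ?f 1 0 + (\<Sum>k\<le>i. ?f (i choose Suc k) (Suc k))"
    by (subst sum.atMost_Suc_shift) simp
  also have "(\<Sum>k\<le>i. monom (of_nat (i choose k) * (D ^^ Suc k) b) (i - k + j))
        + (?f 1 0 + (\<Sum>k\<le>i. ?f (i choose Suc k) (Suc k)))
      = ?f 1 0 + (\<Sum>k\<le>i. ?f (Suc i choose Suc k) (Suc k))"
    by (simp add: sum.distrib [symmetric] add_monom algebra_simps)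
  also have "\<dots> = (\<Sum>k\<le>Suc i. ?f (Suc i choose k) k)"
    by (subst sum.atMost_Suc_shift) simp
  finally show ?case .
qed simp

abbreviation opm :: "'a poly \<Rightarrow> 'a poly \<Rightarrow> 'a poly" (infixl "\<star>" 70) where
  "A \<star> B \<equiv> op_mult D A B"

lemma op_mult_delta: "A \<star> B = (\<Sum>i\<le>degree A. smult (coeff A i) ((delta ^^ i) B))"
proof -
  have "(delta ^^ i) B = (\<Sum>j\<le>degree B. \<Sum>k\<le>i.
      monom (of_nat (i choose k) * (D ^^ k) (coeff B j)) (i - k + j))" for i
    by (subst poly_as_sum_of_monoms [of B, symmetric])
      (simp add: funpow_delta_sum funpow_delta_monom)
  then show ?thesis
    by (simp add: op_mult_def smult_sum_right smult_monom mult.assoc)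
qed

lemma op_mult_delta':
  assumes "degree A \<le> n"
  shows "A \<star> B = (\<Sum>i\<le>n. smult (coeff A i) ((delta ^^ i) B))"
  unfolding op_mult_delta using assms
  by (intro sum.mono_neutral_left) (auto simp: coeff_eq_0)

lemma op_mult_0_left [simp]: "0 \<star> B = 0"
  and op_mult_0_right [simp]: "A \<star> 0 = 0"
  by (simp_all add: op_mult_delta)

lemma op_mult_add_left: "(A + A') \<star> B = A \<star> B + A' \<star> B"
proof -
  let ?n = "max (degree A) (degree A')"
  have "degree (A + A') \<le> ?n"
    by (rule degree_add_le) auto
  then show ?thesis
    by (simp add: op_mult_delta' [of _ ?n] smult_add_left sum.distrib)
qed

lemma op_mult_add_right: "A \<star> (B + B') = A \<star> B + A \<star> B'"
  by (simp add: op_mult_delta funpow_delta_add smult_add_right sum.distrib)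

lemma op_mult_smult_left: "smult c A \<star> B = smult c (A \<star> B)"
  by (simp add: op_mult_delta' [of _ "degree A"] smult_sum_right degree_smult_le)

text \<open>With coefficients on the left, \<open>pCons a A\<close> is the operator
  \<open>a + A \<partial>\<close>, and \<open>\<partial>\<close> is absorbed into the right factor.
  This recursion drives inductions on the left factor, in which \<open>B\<close> has to
  vary.\<close>

lemma op_mult_pCons: "pCons a A \<star> B = smult a B + A \<star> delta B"
proof -
  have "degree (pCons a A) \<le> Suc (degree A)"
    by (rule degree_pCons_le)
  then show ?thesis
    by (simp add: op_mult_delta' [of "pCons a A" "Suc (degree A)"] op_mult_delta [of A]
        sum.atMost_Suc_shift funpow_swap1 del: sum.atMost_Suc)
qed

lemma op_mult_1_left [simp]: "1 \<star> B = B"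
  by (simp add: one_pCons op_mult_pCons)

lemma delta_op_mult: "delta (A \<star> B) = delta A \<star> B"
proof (induction A arbitrary: B)
  case (pCons a A)
  have "delta (pCons a A) = pCons (D a) (delta A + [:a:])"
    by (rule poly_eqI) (auto simp: coeff_delta coeff_pCons split: nat.split)
  then show ?case
    using pCons by (simp add: op_mult_pCons op_mult_add_left delta_add delta_smult add_ac)
qed simp

lemma op_mult_assoc: "A \<star> B \<star> C = A \<star> (B \<star> C)"
proof (induction A arbitrary: B)
  case (pCons a A)
  then show ?case
    by (simp add: op_mult_pCons op_mult_add_left op_mult_smult_left delta_op_mult)
qed simp

lemma op_mult_monom_1: "A \<star> monom 1 j = monom 1 j * A"
proof (induction A arbitrary: j)
  case (pCons a A)
  then show ?case
    using pCons.IH[of "Suc j"] by (simp add: op_mult_pCons delta_monom mult.commute monom_Suc)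
qed simp

lemma op_mult_1_right [simp]: "A \<star> 1 = A"
  using op_mult_monom_1[of A 0] by simp

lemma op_mult_smult_right:
  assumes "c \<in> constants D"
  shows "A \<star> smult c B = smult c (A \<star> B)"
proof (induction A arbitrary: B)
  case (pCons a A)
  have "delta (smult c B) = smult c (delta B)"
    using assms by (simp add: delta_smult constants_def)
  then show ?case
    using pCons by (simp add: op_mult_pCons smult_add_right mult.commute)
qed simp

lemma op_mult_minus_left: "- A \<star> B = - (A \<star> B)"
  using op_mult_smult_left[of "- 1" A B] by simp

lemma op_mult_minus_right: "A \<star> - B = - (A \<star> B)"
  using op_mult_smult_right[of "- 1" A B] minus_constants[OF one_constants] by simp

lemma op_mult_diff_left: "(A - A') \<star> B = A \<star> B - A' \<star> B"
  using op_mult_add_left[of A "- A'" B] by (simp add: op_mult_minus_left)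

lemma op_mult_diff_right: "A \<star> (B - B') = A \<star> B - A \<star> B'"
  using op_mult_add_right[of A B "- B'"] by (simp add: op_mult_minus_right)

section \<open>Strict order bounds and leading coefficients\<close>

definition below :: "nat \<Rightarrow> 'a poly \<Rightarrow> bool" where
  "below d A \<longleftrightarrow> (\<forall>i\<ge>d. coeff A i = 0)"

lemma below_Suc_iff: "below (Suc d) A \<longleftrightarrow> degree A \<le> d"
  by (auto simp: below_def Suc_le_eq coeff_eq_0 intro: degree_le)

lemma below_SucD: "below (Suc d) A \<Longrightarrow> coeff A d = 0 \<Longrightarrow> below d A"
  unfolding below_def by (metis Suc_leI le_neq_implies_less)

lemma below_0_iff: "below 0 A \<longleftrightarrow> A = 0"
  by (simp add: below_def poly_eq_iff)

lemma below_zero [simp]: "below d 0"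
  by (simp add: below_def)

lemma below_mono: "below d A \<Longrightarrow> d \<le> e \<Longrightarrow> below e A"
  by (auto simp: below_def)

lemma below_add: "below d A \<Longrightarrow> below d B \<Longrightarrow> below d (A + B)"
  and below_diff: "below d A \<Longrightarrow> below d B \<Longrightarrow> below d (A - B)"
  and below_smult: "below d A \<Longrightarrow> below d (smult c A)"
  by (auto simp: below_def)

lemma below_delta: "below d A \<Longrightarrow> below (Suc d) (delta A)"
  by (auto simp: below_def coeff_delta coeff_pCons split: nat.split)

text \<open>\<open>below\<close> bounds the order strictly, so \<open>below 0\<close> singles out
  the zero operator, which \<open>degree\<close> cannot. Here \<open>A\<close> has order at most
  \<open>a\<close>, and the strictness comes from \<open>B\<close> alone.\<close>

lemma below_op_mult: "below (Suc a) A \<Longrightarrow> below b B \<Longrightarrow> below (a + b) (A \<star> B)"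
proof (induction a arbitrary: A b B)
  case 0
  then show ?case
    by (auto simp: below_Suc_iff op_mult_pCons intro!: below_smult elim!: degree_eq_zeroE)
next
  case (Suc a)
  obtain c A' where A: "A = pCons c A'"
    by (rule pCons_cases)
  have "below (Suc a) A'"
    using Suc.prems(1) unfolding below_def A by (metis coeff_pCons_Suc Suc_le_mono)
  with Suc.prems have "below (a + Suc b) (A' \<star> delta B)"
    by (intro Suc.IH below_delta)
  then show ?case
    using Suc.prems by (auto simp: A op_mult_pCons intro!: below_add below_smult intro: below_mono)
qed

lemma coeff_delta_top: "below (Suc q) B \<Longrightarrow> coeff (delta B) (Suc q) = coeff B q"
  by (simp add: coeff_delta below_def)

lemma coeff_op_mult_top:
  "below (Suc p) A \<Longrightarrow> below (Suc q) B \<Longrightarrow> coeff (A \<star> B) (p + q) = coeff A p * coeff B q"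
proof (induction p arbitrary: A q B)
  case 0
  then show ?case
    by (auto simp: below_Suc_iff op_mult_pCons elim!: degree_eq_zeroE)
next
  case (Suc p)
  obtain c A' where A: "A = pCons c A'"
    by (rule pCons_cases)
  have "below (Suc p) A'"
    using Suc.prems(1) unfolding below_def A by (metis coeff_pCons_Suc Suc_le_mono)
  then have "coeff (A' \<star> delta B) (p + Suc q) = coeff A' p * coeff B q"
    using Suc.prems by (subst Suc.IH) (simp_all add: below_delta coeff_delta_top)
  then show ?case
    using Suc.prems by (simp add: A op_mult_pCons below_def)
qed

text \<open>The shift \<open>pCons 0\<close> lets the coefficient of order \<open>p + q - 1\<close> be written without truncated
  subtraction, also for \<open>p = q = 0\<close>.\<close>

lemma coeff_op_mult_subtop:
  assumes "below (Suc p) A" "below (Suc q) B"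
  shows "coeff (pCons 0 (A \<star> B)) (p + q) = coeff A p * coeff (pCons 0 B) q
    + coeff (pCons 0 A) p * coeff B q + of_nat p * coeff A p * D (coeff B q)"
  using assms
proof (induction p arbitrary: A q B)
  case 0
  then show ?case
    by (auto simp: below_Suc_iff op_mult_pCons coeff_pCons elim!: degree_eq_zeroE split: nat.split)
next
  case (Suc p)
  obtain c A' where A: "A = pCons c A'"
    by (rule pCons_cases)
  have "below (Suc p) A'"
    using Suc.prems(1) unfolding below_def A by (metis coeff_pCons_Suc Suc_le_mono)
  then have "coeff (pCons 0 (A' \<star> delta B)) (p + Suc q) = coeff A' p * coeff (delta B) q
    + coeff (pCons 0 A') p * coeff B q + of_nat p * coeff A' p * D (coeff B q)"
    using Suc.prems by (subst Suc.IH) (simp_all add: below_delta coeff_delta_top)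
  \<comment> \<open>The summand \<open>smult c B\<close> reaches this order only if
    \<open>p = 0\<close>, that is, if the left factor has order at most 1.\<close>
  moreover have "coeff B (p + q) = (if p = 0 then coeff B q else 0)"
    using Suc.prems(2) by (simp add: below_def)
  ultimately show ?case
    by (cases p) (simp_all add: A op_mult_pCons coeff_delta algebra_simps)
qed

lemma below_degree [simp]: "below (Suc (degree A)) A"
  by (simp add: below_Suc_iff)

lemma lead_coeff_op_mult: "coeff (A \<star> B) (degree A + degree B) = lead_coeff A * lead_coeff B"
  by (simp add: coeff_op_mult_top)

lemma op_mult_eq_0_iff [simp]: "A \<star> B = 0 \<longleftrightarrow> A = 0 \<or> B = 0"
  using lead_coeff_op_mult[of A B] by auto

lemma degree_op_mult:
  assumes "A \<noteq> 0" "B \<noteq> 0"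
  shows "degree (A \<star> B) = degree A + degree B"
proof (rule antisym)
  have "below (degree A + Suc (degree B)) (A \<star> B)"
    by (intro below_op_mult) simp_all
  then show "degree (A \<star> B) \<le> degree A + degree B"
    by (simp add: below_Suc_iff)
  show "degree A + degree B \<le> degree (A \<star> B)"
    using assms by (intro le_degree) (simp add: lead_coeff_op_mult)
qed

end

subsection \<open>Centralizers\<close>

context derivation
begin

lemma centralizer_iff: "A \<in> centralizer D X \<longleftrightarrow> X \<star> A = A \<star> X"
  by (simp add: centralizer_def)

lemma centralizer_commute: "A \<in> centralizer D X \<longleftrightarrow> X \<in> centralizer D A"
  by (auto simp: centralizer_iff)

lemma centralizer_self [simp]: "X \<in> centralizer D X"
  and centralizer_0 [simp]: "0 \<in> centralizer D X"
  and centralizer_1 [simp]: "1 \<in> centralizer D X"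
  by (simp_all add: centralizer_iff)

lemma centralizer_add: "A \<in> centralizer D X \<Longrightarrow> B \<in> centralizer D X \<Longrightarrow> A + B \<in> centralizer D X"
  and centralizer_diff: "A \<in> centralizer D X \<Longrightarrow> B \<in> centralizer D X \<Longrightarrow> A - B \<in> centralizer D X"
  by (simp_all add: centralizer_iff op_mult_add_left op_mult_add_right op_mult_diff_left
      op_mult_diff_right)

lemma centralizer_smult:
  "c \<in> constants D \<Longrightarrow> A \<in> centralizer D X \<Longrightarrow> smult c A \<in> centralizer D X"
  by (simp add: centralizer_iff op_mult_smult_left op_mult_smult_right)

lemma centralizer_mult:
  "A \<in> centralizer D X \<Longrightarrow> B \<in> centralizer D X \<Longrightarrow> A \<star> B \<in> centralizer D X"
  unfolding centralizer_iff by (metis op_mult_assoc)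

lemma centralizer_pow: "A \<in> centralizer D X \<Longrightarrow> op_pow D A k \<in> centralizer D X"
  by (induction k) (auto simp: centralizer_mult)

lemma op_pow_add: "op_pow D A (i + j) = op_pow D A i \<star> op_pow D A j"
  by (induction i) (auto simp: op_mult_assoc)

lemma op_pow_eq_0_iff [simp]: "op_pow D A k = 0 \<longleftrightarrow> A = 0 \<and> k > 0"
  by (induction k) auto

lemma degree_op_pow: "A \<noteq> 0 \<Longrightarrow> degree (op_pow D A k) = k * degree A"
  by (induction k) (auto simp: degree_op_mult)

lemma below_imp_degree_less: "below d A \<Longrightarrow> A \<noteq> 0 \<Longrightarrow> degree A < d"
  by (metis below_def leading_coeff_0_iff not_le)

lemma cancel_lead:
  assumes "A \<noteq> 0" "degree B = degree A"
  shows "below (degree A) (B - smult (lead_coeff B / lead_coeff A) A)"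
  using assms by (auto simp: below_def coeff_eq_0 le_less)

end

section \<open>Commutativity of the centralizer of a monic operator\<close>

locale centralizer_ops = derivation D
  for D :: "'a::field_char_0 \<Rightarrow> 'a" +
  fixes L :: "'a poly"
  assumes monic: "lead_coeff L = 1"
    and order_pos: "degree L > 0"
begin

lemma L_nonzero [simp]: "L \<noteq> 0"
  using order_pos by auto

text \<open>Compare the coefficients one below the top in \<open>L \<star> A = A \<star> L\<close>.
  Since \<open>L\<close> is monic, everything cancels except \<open>degree L\<close> times the
  derivative of the leading coefficient of \<open>A\<close>, and the characteristic is zero.\<close>

lemma lead_coeff_constant:
  assumes "A \<in> centralizer D L"
  shows "lead_coeff A \<in> constants D"
proof -
  have "of_nat (degree L) * D (lead_coeff A) = 0"
    using coeff_op_mult_subtop[of "degree L" L "degree A" A]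
      coeff_op_mult_subtop[of "degree A" A "degree L" L] assms
    by (simp add: centralizer_iff monic add.commute mult.commute)
  then show ?thesis
    using order_pos by (simp add: constants_def)
qed

definition orders :: "nat set" where
  "orders = degree ` (centralizer D L - {0})"

lemma degree_in_orders: "A \<in> centralizer D L \<Longrightarrow> A \<noteq> 0 \<Longrightarrow> degree A \<in> orders"
  by (auto simp: orders_def)

lemma orders_add: "a \<in> orders \<Longrightarrow> b \<in> orders \<Longrightarrow> a + b \<in> orders"
  unfolding orders_def by (auto simp flip: degree_op_mult intro!: imageI centralizer_mult)

lemma orders_mult: "a \<in> orders \<Longrightarrow> k * a \<in> orders"
proof (induction k)
  case 0
  show ?case
    using degree_in_orders[of 1] by simp
qed (auto intro: orders_add)

text \<open>The order classes modulo \<open>degree L\<close> form a subgroup of a cyclic group; \<open>s\<close> represents a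
  generator.\<close>

lemma generating_order:
  obtains s where "s \<in> orders"
    and "\<And>m. m \<in> orders \<Longrightarrow> degree L * s \<le> m \<Longrightarrow> \<exists>q i. m = q * s + i * degree L"
proof -
  let ?n = "degree L"
  \<comment> \<open>The least positive \<open>d\<close> whose class contains an order generates the
    subgroup of these classes; \<open>s\<close> realizes its class.\<close>
  let ?P = "\<lambda>d. d > 0 \<and> (\<exists>s\<in>orders. s mod ?n = d mod ?n)"
  define d where "d = (LEAST d. ?P d)"
  have "?P ?n"
    using order_pos degree_in_orders[of L] by (auto intro!: bexI[of _ "degree L"])
  then have "?P d"
    unfolding d_def by (rule LeastI)
  then obtain s where s: "s \<in> orders" "s mod ?n = d mod ?n" and "d > 0"
    by auto
  have minimal: "\<not> ?P r" if "r < d" for r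
    using that not_less_Least unfolding d_def by blast
  have "\<exists>q i. m = q * s + i * ?n" if m: "m \<in> orders" "?n * s \<le> m" for m
  proof -
    define k where "k = m div d"
    \<comment> \<open>Adding \<open>(?n - 1) * k * s\<close> replaces subtracting
      \<open>k * s\<close> modulo \<open>?n\<close>. So the class of \<open>m mod d\<close> contains
      an order, and minimality of \<open>d\<close> forces \<open>m mod d = 0\<close>.\<close>
    have "(m + (?n - 1) * k * s) mod ?n = (m mod d + k * d + (?n - 1) * k * s) mod ?n"
      by (simp add: k_def)
    also have "\<dots> = (m mod d + k * d + (?n - 1) * k * d) mod ?n"
      using s(2) by (intro mod_add_cong mod_mult_cong refl)
    also have "m mod d + k * d + (?n - 1) * k * d = m mod d + ?n * (k * d)"
      using order_pos by (cases ?n) (auto simp: algebra_simps)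
    finally have "(m + (?n - 1) * k * s) mod ?n = (m mod d) mod ?n"
      by simp
    moreover have "m + (?n - 1) * k * s \<in> orders"
      using m s by (intro orders_add orders_mult)
    ultimately have "m mod d = 0"
      using minimal[of "m mod d"] \<open>d > 0\<close> by auto
    then have "m = k * d"
      by (auto simp: k_def)
    \<comment> \<open>Reducing \<open>k\<close> modulo \<open>?n\<close> keeps the class of
      \<open>q * s\<close> and gives \<open>q * s \<le> ?n * s \<le> m\<close>, so what remains is a
      natural multiple of \<open>?n\<close>.\<close>
    define q where "q = k mod ?n"
    have "q * s \<le> m"
      using m(2) order_pos by (intro order.trans[OF mult_le_mono1 m(2)]) (simp add: q_def less_imp_le)
    moreover have "(q * s) mod ?n = m mod ?n"
      unfolding \<open>m = k * d\<close> q_def using s(2) by (intro mod_mult_cong) auto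
    ultimately obtain i where "m = q * s + i * ?n"
      by (metis mod_eq_nat2E mult.commute)
    then show ?thesis
      by blast
  qed
  with s(1) show thesis
    using that by blast
qed

text \<open>Leading terms are cancelled by constant multiples of products \<open>A^q L^i\<close>,
  down to order \<open>N\<close>. \<open>M\<close> is described only by what is used later: it
  commutes with whatever commutes with \<open>L\<close> and \<open>A\<close>.\<close>

lemma centralizer_split:
  obtains A N where "A \<in> centralizer D L"
    and "\<And>B. B \<in> centralizer D L \<Longrightarrow> \<exists>M R. B = M + R \<and> below N R \<and>
      (\<forall>X. L \<in> centralizer D X \<longrightarrow> A \<in> centralizer D X \<longrightarrow> M \<in> centralizer D X)"
proof -
  obtain s where "s \<in> orders"
    and s: "\<And>m. m \<in> orders \<Longrightarrow> degree L * s \<le> m \<Longrightarrow> \<exists>q i. m = q * s + i * degree L"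
    using generating_order by blast
  then obtain A where A: "A \<in> centralizer D L" "A \<noteq> 0" "degree A = s"
    by (auto simp: orders_def)
  define N where "N = degree L * s"
  have "\<exists>M R. B = M + R \<and> below N R \<and>
      (\<forall>X. L \<in> centralizer D X \<longrightarrow> A \<in> centralizer D X \<longrightarrow> M \<in> centralizer D X)"
    if "B \<in> centralizer D L" "below k B" for B k
    using that
  proof (induction k arbitrary: B)
    case 0
    then show ?case
      by (intro exI[of _ 0]) (auto simp: below_0_iff)
  next
    case (Suc k)
    consider "Suc k \<le> N" | "below k B" | "N \<le> k" "degree B = k" "B \<noteq> 0"
      by (metis Suc.prems(2) below_imp_degree_less below_mono below_zero below_Suc_iff
          less_Suc_eq not_less_eq_eq less_Suc_eq_le Suc_leI below_degree)
    then show ?case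
    proof cases
      case 1
      then show ?thesis
        using below_mono[OF Suc.prems(2)] by (intro exI[of _ 0] exI[of _ B]) auto
    next
      case 2
      then show ?thesis
        using Suc by blast
    next
      case 3
      then obtain q i where qi: "degree B = q * s + i * degree L"
        using s[of "degree B"] degree_in_orders[OF Suc.prems(1)] by (auto simp: N_def)
      define T where "T = op_pow D A q \<star> op_pow D L i"
      have T: "T \<in> centralizer D L" "T \<noteq> 0" "degree T = degree B"
        using A by (auto simp: T_def qi degree_op_mult degree_op_pow centralizer_mult centralizer_pow)
      define c where "c = lead_coeff B / lead_coeff T"
      have c: "c \<in> constants D"
        using T(1) Suc.prems(1)
        by (simp add: c_def divide_inverse mult_constants inverse_constants lead_coeff_constant)
      have "below k (B - smult c T)"
        using cancel_lead[of T B] T 3 by (simp add: c_def)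
      moreover have "B - smult c T \<in> centralizer D L"
        using T c Suc.prems by (intro centralizer_diff centralizer_smult)
      ultimately obtain M R where MR: "B - smult c T = M + R" "below N R"
        and M: "\<And>X. L \<in> centralizer D X \<Longrightarrow> A \<in> centralizer D X \<Longrightarrow> M \<in> centralizer D X"
        using Suc.IH by blast
      show ?thesis
      proof (intro exI conjI allI impI)
        show "B = smult c T + M + R"
          using MR(1) by (simp add: algebra_simps)
        show "smult c T + M \<in> centralizer D X"
          if "L \<in> centralizer D X" "A \<in> centralizer D X" for X
          unfolding T_def using that c
          by (intro centralizer_add M centralizer_smult centralizer_mult centralizer_pow)
      qed fact
    qed
  qed
  then show thesis
    using that[of A N] A(1) below_degree by blast
qed

text \<open>The claim \<open>commutes\<close> is used twice: with \<open>X = A\<close> it shows that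
  \<open>A\<close> commutes with the whole centralizer, after which it applies to every
  \<open>X\<close> there.\<close>

theorem centralizer_commutative:
  assumes "B \<in> centralizer D L" "B' \<in> centralizer D L"
  shows "B \<in> centralizer D B'"
proof -
  obtain A N where A: "A \<in> centralizer D L"
    and split: "\<And>B. B \<in> centralizer D L \<Longrightarrow> \<exists>M R. B = M + R \<and> below N R \<and>
      (\<forall>X. L \<in> centralizer D X \<longrightarrow> A \<in> centralizer D X \<longrightarrow> M \<in> centralizer D X)"
    using centralizer_split by blast
  have commutes: "B \<in> centralizer D X"
    if X: "X \<in> centralizer D L" "A \<in> centralizer D X" and B: "B \<in> centralizer D L" for X B
  proof (rule ccontr)
    assume contra: "B \<notin> centralizer D X"
    define E where "E = X \<star> B - B \<star> X"
    have "E \<noteq> 0"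
      using contra by (auto simp: E_def centralizer_iff)
    define i where "i = Suc (degree X + N)"
    define P where "P = op_pow D L i"
    have P: "P \<in> centralizer D L" "P \<in> centralizer D X"
      using X by (auto simp: P_def centralizer_pow centralizer_commute[of L])
    obtain M R where MR: "P \<star> B = M + R" "below N R" "M \<in> centralizer D X"
      using split[of "P \<star> B"] X P B by (auto simp: centralizer_mult centralizer_commute[of L])
    \<comment> \<open>Multiplying by \<open>P\<close> raises the order of \<open>E\<close>, but the commutator of \<open>X\<close> with
      \<open>P \<star> B\<close> is that of \<open>X\<close> with the remainder \<open>R\<close>, of bounded order.\<close>
    have "P \<star> E = X \<star> (P \<star> B) - (P \<star> B) \<star> X"
      using P(2) unfolding E_def by (metis centralizer_iff op_mult_assoc op_mult_diff_right)
    also have "\<dots> = X \<star> R - R \<star> X"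
      using MR by (simp add: op_mult_add_left op_mult_add_right centralizer_iff)
    also have "below i \<dots>"
      using below_op_mult[of "degree X" X N R] below_op_mult[of N R "Suc (degree X)" X] MR(2) below_mono[of N R "Suc N"]
      by (intro below_diff) (auto simp: i_def ac_simps intro: below_mono)
    finally have "degree (P \<star> E) < i"
      using \<open>E \<noteq> 0\<close> by (intro below_imp_degree_less) (auto simp: P_def)
    then have "i * degree L + degree E < i"
      using \<open>E \<noteq> 0\<close> by (simp add: degree_op_mult P_def degree_op_pow)
    then have "i * degree L < i * 1"
      unfolding mult_1_right by (rule add_lessD1)
    then show False
      using order_pos unfolding mult_less_cancel1 by simp
  qed
  have "A \<in> centralizer D B" if "B \<in> centralizer D L" for B
    using commutes[of A B] A that by (simp add: centralizer_commute[of A B])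
  then show ?thesis
    using commutes assms by blast
qed

end

subsection \<open>Polynomials over the differential field\<close>

abbreviation const :: "'a::comm_ring_1 \<Rightarrow> 'a mpoly" where
  "const \<equiv> Poly_Mapping.single 0"

lemma lookup_const_mult [simp]:
  "Poly_Mapping.lookup (const c * p) m = c * Poly_Mapping.lookup p m"
  by (simp add: Poly_Mapping.map.rep_eq when_def flip: mult_map_scale_conv_mult)

lemma const_mult_const: "const a * (const b * p) = const (a * b) * p"
  by (simp add: mult_single flip: mult.assoc)

lemma mpoly_as_sum_of_singles:
  "(p :: 'a::comm_ring_1 mpoly)
    = (\<Sum>m\<in>Poly_Mapping.keys p. Poly_Mapping.single m (Poly_Mapping.lookup p m))"
  by (rule poly_mapping_eqI)
    (simp add: lookup_sum lookup_single when_def in_keys_iff sum.delta')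

lemma polys_in_0 [simp]: "0 \<in> polys_in t"
  and polys_in_1 [simp]: "1 \<in> polys_in t"
  and polys_in_const [simp]: "const c \<in> polys_in t"
  by (simp_all add: polys_in_def)

lemma polys_in_add: "p \<in> polys_in t \<Longrightarrow> q \<in> polys_in t \<Longrightarrow> p + q \<in> polys_in t"
  using Poly_Mapping.keys_add[of p q] by (auto simp: polys_in_def)

lemma polys_in_mult:
  assumes "p \<in> polys_in t" "q \<in> polys_in t"
  shows "p * q \<in> polys_in t"
  unfolding polys_in_def
proof (intro CollectI ballI)
  fix m v
  assume "m \<in> Poly_Mapping.keys (p * q)" and v: "v \<in> Poly_Mapping.keys m"
  then obtain a b where "m = a + b" "a \<in> Poly_Mapping.keys p" "b \<in> Poly_Mapping.keys q"
    using keys_mult[of p q] by auto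
  then show "v < t"
    using assms v Poly_Mapping.keys_add[of a b] by (auto simp: polys_in_def)
qed

lemma polys_in_diff: "p \<in> polys_in t \<Longrightarrow> q \<in> polys_in t \<Longrightarrow> p - q \<in> polys_in t"
  using Poly_Mapping.keys_diff[of p q] by (auto simp: polys_in_def)

section \<open>Linear spans and polynomials with constant coefficients\<close>

inductive_set scalar_span :: "'a::comm_ring_1 mpoly set \<Rightarrow> 'a mpoly set" for X where
  zero: "0 \<in> scalar_span X"
| step: "p \<in> X \<Longrightarrow> q \<in> scalar_span X \<Longrightarrow> const c * p + q \<in> scalar_span X"

lemma scalar_span_add: "p \<in> scalar_span X \<Longrightarrow> q \<in> scalar_span X \<Longrightarrow> p + q \<in> scalar_span X"
  by (induction p rule: scalar_span.induct) (auto simp: add.assoc intro: scalar_span.step)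

lemma scalar_span_base: "p \<in> X \<Longrightarrow> const c * p \<in> scalar_span X"
  using scalar_span.step[OF _ scalar_span.zero, of p X c] by simp

lemma scalar_span_mono: "p \<in> scalar_span X \<Longrightarrow> X \<subseteq> Y \<Longrightarrow> p \<in> scalar_span Y"
  by (induction p rule: scalar_span.induct) (auto intro: scalar_span.intros)

lemma scalar_span_sum: "(\<And>i. i \<in> I \<Longrightarrow> f i \<in> scalar_span X) \<Longrightarrow> sum f I \<in> scalar_span X"
  by (induction I rule: infinite_finite_induct) (auto intro: scalar_span_add scalar_span.zero)

context derivation
begin

lemma op_mult_sum_left: "sum f I \<star> B = (\<Sum>i\<in>I. f i \<star> B)"
  by (induction I rule: infinite_finite_induct) (auto simp: op_mult_add_left)

lemma op_mult_sum_right: "A \<star> sum f I = (\<Sum>i\<in>I. A \<star> f i)"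
  by (induction I rule: infinite_finite_induct) (auto simp: op_mult_add_right)

lemma lookup_mpoly_deriv: "Poly_Mapping.lookup (mpoly_deriv D p) m = D (Poly_Mapping.lookup p m)"
  by (simp add: mpoly_deriv_def Poly_Mapping.map.rep_eq when_def)

lemma mpoly_deriv_0: "mpoly_deriv D 0 = 0"
  by (rule poly_mapping_eqI) (simp add: lookup_mpoly_deriv)

lemma op_mult_interchange:
  assumes "C \<in> centralizer D B"
  shows "A \<star> B \<star> (C \<star> E) = A \<star> C \<star> (B \<star> E)"
proof -
  have "B \<star> (C \<star> E) = C \<star> (B \<star> E)"
    using assms by (simp add: centralizer_iff flip: op_mult_assoc)
  then show ?thesis
    by (simp add: op_mult_assoc)
qed

definition const_polys :: "nat \<Rightarrow> 'a mpoly set" where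
  "const_polys t = {p \<in> polys_in t. \<forall>m. Poly_Mapping.lookup p m \<in> constants D}"

text \<open>Only the scalar is differentiated, so spans of polynomials with constant coefficients
  are stable under \<open>mpoly_deriv\<close>.\<close>

lemma mpoly_deriv_step:
  assumes "p \<in> const_polys t"
  shows "mpoly_deriv D (const c * p + q) = const (D c) * p + mpoly_deriv D q"
  by (rule poly_mapping_eqI)
    (use assms in \<open>simp add: lookup_mpoly_deriv lookup_add const_polys_def constants_def\<close>)

lemma const_polys_diff: "p \<in> const_polys t \<Longrightarrow> q \<in> const_polys t \<Longrightarrow> p - q \<in> const_polys t"
  by (simp add: const_polys_def polys_in_diff lookup_minus diff_constants)

lemma const_polys_const_mult:
  "c \<in> constants D \<Longrightarrow> p \<in> const_polys t \<Longrightarrow> const c * p \<in> const_polys t"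
  by (auto simp: const_polys_def polys_in_mult mult_constants)

end

subsection \<open>The Burchnall--Chaundy ideal\<close>

locale commuting_ops = centralizer_ops D L
  for D :: "'a::field_char_0 \<Rightarrow> 'a" and L +
  fixes t :: nat and G :: "nat \<Rightarrow> 'a poly"
  assumes G_centralizer: "k < t \<Longrightarrow> G k \<in> centralizer D L"
begin

abbreviation phi :: "'a mpoly \<Rightarrow> 'a poly" where
  "phi \<equiv> phi_L D t L G"

abbreviation gen :: "nat \<Rightarrow> 'a poly" where
  "gen v \<equiv> if v = 0 then L else G v"

text \<open>The product in \<open>phi_L\<close>, taken over an arbitrary list to allow induction on
  the list.\<close>

definition mono_on_list :: "nat list \<Rightarrow> (nat \<Rightarrow>\<^sub>0 nat) \<Rightarrow> 'a poly" where
  "mono_on_list vs m =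
    foldr (\<lambda>v acc. op_mult D (op_pow D (gen v) (Poly_Mapping.lookup m v)) acc) vs 1"

abbreviation mono_op :: "(nat \<Rightarrow>\<^sub>0 nat) \<Rightarrow> 'a poly" where
  "mono_op \<equiv> mono_on_list [0..<t]"

lemma gen_centralizer: "v < t \<Longrightarrow> gen v \<in> centralizer D L"
  by (simp add: G_centralizer)

lemma mono_on_list_centralizer: "set vs \<subseteq> {..<t} \<Longrightarrow> mono_on_list vs m \<in> centralizer D L"
proof (induction vs)
  case (Cons v vs)
  then show ?case
    using gen_centralizer[of v] by (simp add: mono_on_list_def centralizer_mult centralizer_pow)
qed (simp add: mono_on_list_def)

lemma mono_op_centralizer: "mono_op m \<in> centralizer D L"
  by (rule mono_on_list_centralizer) auto

lemma mono_on_list_0: "mono_on_list vs 0 = 1"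
  by (induction vs) (auto simp: mono_on_list_def)

text \<open>Collecting the two powers of each generator swaps factors; here commutativity of the
  centralizer enters.\<close>

lemma mono_on_list_add:
  "set vs \<subseteq> {..<t} \<Longrightarrow> mono_on_list vs (m + m') = mono_on_list vs m \<star> mono_on_list vs m'"
proof (induction vs)
  case (Cons v vs)
  let ?P = "\<lambda>m. op_pow D (gen v) (Poly_Mapping.lookup m v)"
  have "mono_on_list vs m \<in> centralizer D (?P m')"
    using Cons.prems gen_centralizer[of v]
    by (auto intro!: centralizer_commutative[OF mono_on_list_centralizer centralizer_pow])
  then have "?P m \<star> ?P m' \<star> (mono_on_list vs m \<star> mono_on_list vs m')
      = (?P m \<star> mono_on_list vs m) \<star> (?P m' \<star> mono_on_list vs m')"
    by (rule op_mult_interchange)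
  moreover have "mono_on_list (v # vs) m = ?P m \<star> mono_on_list vs m" for m
    by (simp add: mono_on_list_def)
  moreover have "?P (m + m') = ?P m \<star> ?P m'"
    by (simp only: lookup_add op_pow_add)
  moreover have "mono_on_list vs (m + m') = mono_on_list vs m \<star> mono_on_list vs m'"
    using Cons by simp
  ultimately show ?case
    by (simp only:)
qed (simp add: mono_on_list_def)

lemma mono_op_add: "mono_op (m + m') = mono_op m \<star> mono_op m'"
  by (rule mono_on_list_add) auto

section \<open>Evaluation as a linear map over the field\<close>

lemma phi_eq: "phi P = (\<Sum>m\<in>Poly_Mapping.keys P. smult (Poly_Mapping.lookup P m) (mono_op m))"
  by (simp add: phi_L_def mono_on_list_def)

lemma phi_eq':
  assumes "finite A" "Poly_Mapping.keys P \<subseteq> A"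
  shows "phi P = (\<Sum>m\<in>A. smult (Poly_Mapping.lookup P m) (mono_op m))"
  unfolding phi_eq using assms by (intro sum.mono_neutral_left) (auto simp: in_keys_iff)

lemma phi_0 [simp]: "phi 0 = 0"
  by (simp add: phi_eq)

lemma phi_add [simp]: "phi (P + Q) = phi P + phi Q"
proof -
  let ?A = "Poly_Mapping.keys P \<union> Poly_Mapping.keys Q"
  show ?thesis
    using Poly_Mapping.keys_add[of P Q]
    by (simp add: phi_eq' [of ?A] lookup_add smult_add_left sum.distrib)
qed

lemma phi_const_mult [simp]: "phi (const c * P) = smult c (phi P)"
proof -
  have "Poly_Mapping.keys (const c * P) \<subseteq> Poly_Mapping.keys P"
    by (auto simp: in_keys_iff)
  then show ?thesis
    by (simp add: phi_eq' [of "Poly_Mapping.keys P"] smult_sum_right)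
qed

lemma phi_diff [simp]: "phi (P - Q) = phi P - phi Q"
  using phi_add[of "P - Q" Q] by (simp add: algebra_simps del: phi_add)

lemma phi_sum: "phi (sum f I) = (\<Sum>i\<in>I. phi (f i))"
  by (induction I rule: infinite_finite_induct) auto

lemma phi_single: "phi (Poly_Mapping.single m c) = smult c (mono_op m)"
  by (simp add: phi_eq' [of "{m}"])

lemma phi_1 [simp]: "phi 1 = 1"
  using phi_single[of 0 1] by (simp add: mono_on_list_0)

text \<open>The coefficients of \<open>Q\<close> move left past operators coming from
  \<open>P\<close>, hence must be constant; those of \<open>P\<close> already stand on the
  left.\<close>

lemma phi_mult:
  assumes "Q \<in> const_polys t"
  shows "phi (P * Q) = phi P \<star> phi Q"
proof -
  let ?c = Poly_Mapping.lookup
  have "phi (P * Q) = phi ((\<Sum>m\<in>Poly_Mapping.keys P. Poly_Mapping.single m (?c P m))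
      * (\<Sum>m\<in>Poly_Mapping.keys Q. Poly_Mapping.single m (?c Q m)))"
    by (simp flip: mpoly_as_sum_of_singles)
  also have "\<dots> = (\<Sum>m\<in>Poly_Mapping.keys P. \<Sum>m'\<in>Poly_Mapping.keys Q.
      smult (?c P m * ?c Q m') (mono_op m \<star> mono_op m'))"
    by (simp add: sum_product mult_single phi_sum phi_single mono_op_add)
  also have "\<dots> = phi P \<star> phi Q"
    using assms
    by (simp add: phi_eq op_mult_sum_left op_mult_sum_right op_mult_smult_left
        op_mult_smult_right const_polys_def) (rule sum.swap)
  finally show ?thesis .
qed

lemma phi_centralizer:
  assumes "p \<in> const_polys t"
  shows "phi p \<in> centralizer D L"
proof -
  have "(\<Sum>m\<in>A. smult (Poly_Mapping.lookup p m) (mono_op m)) \<in> centralizer D L" for A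
    using assms
    by (induction A rule: infinite_finite_induct)
      (auto simp: const_polys_def intro!: centralizer_add centralizer_smult mono_op_centralizer)
  then show ?thesis
    by (simp add: phi_eq)
qed

section \<open>The order filtration\<close>

definition filt :: "nat \<Rightarrow> 'a mpoly set" where
  "filt d = scalar_span {p \<in> const_polys t. below d (phi p)}"

lemma filt_mono: "P \<in> filt d \<Longrightarrow> d \<le> e \<Longrightarrow> P \<in> filt e"
  unfolding filt_def by (erule scalar_span_mono) (auto intro: below_mono)

lemma filt_polys_in: "P \<in> filt d \<Longrightarrow> P \<in> polys_in t"
  unfolding filt_def
  by (induction P rule: scalar_span.induct)
    (auto simp: const_polys_def intro!: polys_in_add polys_in_mult)

lemma filt_below: "P \<in> filt d \<Longrightarrow> below d (phi P)"
  unfolding filt_def by (induction P rule: scalar_span.induct) (auto intro: below_add below_smult)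

text \<open>This is why \<open>filt\<close> is a span and not just a bound on \<open>phi\<close>:
  the generators of \<open>Q\<close> have constant coefficients, so \<open>phi_mult\<close> applies
  to them, and scalars leave the commutative product freely.\<close>

lemma const_polys_mult_filt_below:
  assumes "p \<in> const_polys t" "below (Suc a) (phi p)" "Q \<in> filt b"
  shows "below (a + b) (phi (p * Q))"
  using assms(3) unfolding filt_def
proof (induction Q rule: scalar_span.induct)
  case (step q Q c)
  have "p * (const c * q + Q) = const c * (p * q) + p * Q"
    by (simp add: algebra_simps)
  then show ?case
    using step assms by (auto simp: phi_mult intro!: below_add below_smult below_op_mult)
qed simp

lemma filt_mult_below:
  assumes "P \<in> filt (Suc a)" "Q \<in> filt b"
  shows "below (a + b) (phi (P * Q))"
  using assms(1) unfolding filt_def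
proof (induction P rule: scalar_span.induct)
  case (step p P c)
  have "(const c * p + P) * Q = const c * (p * Q) + P * Q"
    by (simp add: algebra_simps)
  then show ?case
    using step assms(2) by (auto intro!: below_add below_smult const_polys_mult_filt_below)
qed simp

text \<open>\<open>phi p\<close> is normalized to be monic, so that \<open>k\<close> is the
  coefficient of order \<open>d\<close> in \<open>phi P\<close>.\<close>

definition leading_form :: "nat \<Rightarrow> 'a \<Rightarrow> 'a mpoly \<Rightarrow> 'a mpoly \<Rightarrow> 'a mpoly \<Rightarrow> bool" where
  "leading_form d k p R P \<longleftrightarrow> k \<noteq> 0 \<and> p \<in> const_polys t \<and> below (Suc d) (phi p) \<and>
     coeff (phi p) d = 1 \<and> R \<in> filt d \<and> P = const k * p + R"

text \<open>The graded pieces of \<open>filt\<close> are at most one-dimensional, because operators commuting with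
  \<open>L\<close> have constant leading coefficients.\<close>

lemma filt_Suc_cases:
  assumes "P \<in> filt (Suc d)"
  shows "P \<in> filt d \<or> (\<exists>k p R. leading_form d k p R P)"
  using assms unfolding filt_def[of "Suc d"]
proof (induction P rule: scalar_span.induct)
  case zero
  then show ?case
    by (simp add: filt_def scalar_span.zero)
next
  case (step b P c)
  define l where "l = coeff (phi b) d"
  show ?case
  proof (cases "c * l = 0")
    case True
    then have b: "const c * b \<in> filt d"
    proof (cases "c = 0")
      case False
      then have "below d (phi b)"
        using step.hyps True by (auto simp: l_def intro: below_SucD[of d])
      then show ?thesis
        using step.hyps by (auto simp: filt_def intro: scalar_span_base)
    qed (simp add: filt_def scalar_span.zero)
    have "leading_form d k p (const c * b + R) (const c * b + P)" if "leading_form d k p R P" for k p R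
      using that b by (auto simp: leading_form_def filt_def scalar_span_add add_ac)
    moreover have "const c * b + P \<in> filt d" if "P \<in> filt d"
      using that b by (simp add: filt_def scalar_span_add)
    ultimately show ?thesis
      using step.IH by blast
  next
    case False
    then have "degree (phi b) = d"
      using step.hyps by (intro antisym le_degree) (auto simp: l_def below_Suc_iff)
    then have "l \<in> constants D"
      using lead_coeff_constant[of "phi b"] step.hyps phi_centralizer by (simp add: l_def)
    define b' where "b' = const (inverse l) * b"
    have b': "b' \<in> const_polys t" "below (Suc d) (phi b')" "coeff (phi b') d = 1"
      using step.hyps False \<open>l \<in> constants D\<close>
      by (auto simp: b'_def l_def const_polys_const_mult inverse_constants below_smult)
    have b_eq: "const c * b = const (c * l) * b'"
      using False by (simp add: b'_def const_mult_const mult.assoc)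
    from step.IH show ?thesis
    proof (elim disjE exE)
      assume "P \<in> filt d"
      then have "leading_form d (c * l) b' P (const c * b + P)"
        using b' False by (simp add: leading_form_def b_eq)
      then show ?thesis
        by blast
    next
      fix k p R
      assume lead: "leading_form d k p R P"
      then have "below (Suc d) (phi (b' - p))" "coeff (phi (b' - p)) d = 0"
        using b' by (simp_all add: leading_form_def below_diff)
      \<comment> \<open>Two normalized operators of order \<open>d\<close> differ by lower order, so
        \<open>p\<close> alone can carry the leading part.\<close>
      then have "below d (phi (b' - p))"
        by (rule below_SucD)
      moreover have "b' - p \<in> const_polys t"
        using lead b' by (simp add: leading_form_def const_polys_diff)
      moreover define R' where "R' = const (c * l) * (b' - p) + R"
      ultimately have R': "R' \<in> filt d"
        using lead unfolding R'_def leading_form_def filt_def by (intro scalar_span.step) simp_all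
      have eq: "const c * b + P = const (c * l + k) * p + R'"
        using lead unfolding b_eq by (simp add: R'_def leading_form_def single_add algebra_simps)
      show ?thesis
      \<comment> \<open>The leading scalars may cancel, and then the sum drops into
        \<open>filt d\<close>.\<close>
      proof (cases "c * l + k = 0")
        case True
        then show ?thesis
          using R' by (simp add: eq)
      next
        case False
        then have "leading_form d (c * l + k) p R' (const c * b + P)"
          using lead R' eq by (simp add: leading_form_def)
        then show ?thesis
          by blast
      qed
    qed
  qed
qed

lemma filt_exhaustive:
  assumes "P \<in> polys_in t"
  shows "\<exists>d. P \<in> filt d"
proof -
  let ?X = "\<lambda>m. Poly_Mapping.single m (1 :: 'a)"
  \<comment> \<open>For \<open>P = 0\<close> the maximum of the empty set is unspecified; this is
    harmless, as there is no monomial to bound.\<close>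
  define d where "d = Suc (Max ((\<lambda>m. degree (mono_op m)) ` Poly_Mapping.keys P))"
  have "Poly_Mapping.single m (Poly_Mapping.lookup P m) \<in> filt d" if m: "m \<in> Poly_Mapping.keys P" for m
  proof -
    have "degree (mono_op m) < d"
      using m unfolding d_def less_Suc_eq_le by (intro Max_ge) auto
    then have "below d (phi (?X m))"
      by (auto simp: phi_single below_def coeff_eq_0)
    moreover have "?X m \<in> const_polys t"
      using assms m by (auto simp: const_polys_def polys_in_def lookup_single when_def)
    moreover have "Poly_Mapping.single m (Poly_Mapping.lookup P m) = const (Poly_Mapping.lookup P m) * ?X m"
      by (simp add: mult_single)
    ultimately show ?thesis
      by (simp add: filt_def scalar_span_base)
  qed
  then have "P \<in> filt d"
    by (subst mpoly_as_sum_of_singles) (auto simp: filt_def intro: scalar_span_sum)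
  then show ?thesis ..
qed

text \<open>Descend the filtration: a leading form at level \<open>d\<close> would give
  \<open>phi P\<close> the nonzero coefficient \<open>k\<close> there. As \<open>filt 0\<close> is
  the span of the Burchnall--Chaundy ideal, this determines the kernel of
  \<open>phi\<close>.\<close>

lemma filt_0_iff: "P \<in> filt 0 \<longleftrightarrow> P \<in> polys_in t \<and> phi P = 0"
proof
  assume "P \<in> filt 0"
  then show "P \<in> polys_in t \<and> phi P = 0"
    using filt_polys_in filt_below by (force simp: below_0_iff)
next
  assume P: "P \<in> polys_in t \<and> phi P = 0"
  then obtain d where "P \<in> filt d"
    using filt_exhaustive by blast
  then show "P \<in> filt 0"
  proof (induction d)
    case (Suc d)
    have "\<not> leading_form d k p R P" for k p R
    proof
      assume lead: "leading_form d k p R P"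
      then have "coeff (phi P) d = k"
        using filt_below[of R d] by (simp add: leading_form_def below_def)
      then show False
        using lead P by (simp add: leading_form_def)
    qed
    then show ?case
      using Suc filt_Suc_cases by blast
  qed
qed

lemma leading_form_exists:
  assumes "P \<in> polys_in t" "phi P \<noteq> 0"
  shows "\<exists>d k p R. leading_form d k p R P"
proof -
  obtain d where "P \<in> filt d"
    using filt_exhaustive assms by blast
  then show ?thesis
  proof (induction d)
    case 0
    then show ?case
      using assms filt_0_iff by blast
  next
    case (Suc d)
    then show ?case
      using filt_Suc_cases by blast
  qed
qed

text \<open>Although \<open>phi\<close> is not multiplicative, leading scalars \<open>k\<close> at
  order \<open>d\<close> and \<open>l\<close> at order \<open>e\<close> yield the coefficient
  \<open>k * l\<close> at order \<open>d + e\<close>.\<close>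

lemma phi_mult_eq_0:
  assumes "P \<in> polys_in t" "Q \<in> polys_in t" "phi (P * Q) = 0"
  shows "phi P = 0 \<or> phi Q = 0"
proof (rule ccontr)
  assume "\<not> ?thesis"
  then obtain d k p R e l q S where P: "leading_form d k p R P" and Q: "leading_form e l q S Q"
    using leading_form_exists assms by meson
  have p: "p \<in> const_polys t" "below (Suc d) (phi p)" "coeff (phi p) d = 1"
    and q: "q \<in> const_polys t" "below (Suc e) (phi q)" "coeff (phi q) e = 1"
    and R: "R \<in> filt d" and S: "S \<in> filt e"
    using P Q by (auto simp: leading_form_def)
  have Q': "Q \<in> filt (Suc e)"
    using Q q filt_mono[OF S, of "Suc e"]
    by (auto simp: leading_form_def filt_def intro: scalar_span.step)
  have "coeff (phi (p * S)) (d + e) = 0"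
    using const_polys_mult_filt_below[OF p(1,2) S] by (simp add: below_def)
  moreover have "coeff (phi (R * Q)) (d + e) = 0"
    using filt_mult_below[OF Q' R] by (simp add: below_def ac_simps)
  moreover have "P * Q = const (k * l) * (p * q) + const k * (p * S) + R * Q"
  proof -
    have "P * Q = const k * p * Q + R * Q" "Q = const l * q + S"
      using P Q by (simp_all add: leading_form_def algebra_simps)
    then show ?thesis
      by (simp add: algebra_simps flip: mult_single[of 0 _ 0, simplified])
  qed
  ultimately have "coeff (phi (P * Q)) (d + e) = k * l * coeff (phi p \<star> phi q) (d + e)"
    using q(1) by (simp add: phi_mult)
  also have "\<dots> = k * l"
    using p q by (simp add: coeff_op_mult_top)
  finally show False
    using P Q assms(3) by (simp add: leading_form_def)
qed

section \<open>The differential ideal as the kernel of \<open>phi\<close>\<close>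

lemma BC_eq: "BC D t L G = {p \<in> const_polys t. below 0 (phi p)}"
  by (auto simp: BC_def const_polys_def below_0_iff)

text \<open>To make \<open>phi_mult\<close> applicable, \<open>Q\<close> is placed on the right and
  expanded into polynomials with constant coefficients.\<close>

lemma phi_mult_eq_0_right:
  assumes "phi P = 0" "Q \<in> polys_in t"
  shows "phi (Q * P) = 0"
proof -
  obtain d where "Q \<in> filt d"
    using filt_exhaustive assms by blast
  then have "phi (P * Q) = 0"
    unfolding filt_def
  proof (induction Q rule: scalar_span.induct)
    case (step q Q c)
    have "P * (const c * q + Q) = const c * (P * q) + P * Q"
      by (simp add: algebra_simps)
    then show ?case
      using step assms by (simp add: phi_mult)
  qed simp
  then show ?thesis
    by (simp add: mult.commute)
qed

text \<open>The kernel is the span of the Burchnall--Chaundy ideal. Differentiating only changes the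
  scalars, so it is a differential ideal, and every ideal containing the generators contains their
  span.\<close>

lemma diff_ideal_gen_BC: "diff_ideal_gen D t (BC D t L G) = {P \<in> polys_in t. phi P = 0}"
proof
  let ?K = "{P \<in> polys_in t. phi P = 0}"
  have K: "?K = scalar_span (BC D t L G)"
    using filt_0_iff by (auto simp: filt_def BC_eq)
  have "mpoly_deriv D P \<in> scalar_span (BC D t L G)" if "P \<in> scalar_span (BC D t L G)" for P
    using that
  proof (induction P rule: scalar_span.induct)
    case (step p q c)
    then show ?case
      using mpoly_deriv_step[of p t c q] by (simp add: BC_eq scalar_span.step)
  qed (simp add: mpoly_deriv_0 scalar_span.zero)
  moreover have "BC D t L G \<subseteq> ?K"
    by (auto simp: BC_def)
  ultimately show "diff_ideal_gen D t (BC D t L G) \<subseteq> ?K"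
    unfolding diff_ideal_gen_def
    by (intro Inter_lower) (auto simp: polys_in_add polys_in_mult phi_mult_eq_0_right simp flip: K)
  have "scalar_span (BC D t L G) \<subseteq> I"
    if "BC D t L G \<subseteq> I" "0 \<in> I" "\<forall>a\<in>I. \<forall>b\<in>I. a + b \<in> I" "\<forall>a\<in>I. \<forall>r\<in>polys_in t. r * a \<in> I" for I
  proof
    fix P
    assume "P \<in> scalar_span (BC D t L G)"
    then show "P \<in> I"
      using that by (induction P rule: scalar_span.induct) (auto simp: subset_iff)
  qed
  then show "?K \<subseteq> diff_ideal_gen D t (BC D t L G)"
    unfolding K diff_ideal_gen_def by blast
qed

lemma diff_ideal_gen_closed:
  "a \<in> diff_ideal_gen D t S \<Longrightarrow> mpoly_deriv D a \<in> diff_ideal_gen D t S"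
  by (auto simp: diff_ideal_gen_def)

end

theorem theorem6p3:
  fixes D :: "'a::field_char_0 \<Rightarrow> 'a" and L :: "'a poly" and n t :: nat
    and G :: "nat \<Rightarrow> 'a poly"
  assumes "is_derivation D"
    and "constants_alg_closed D"
    and "normal_form_op n L"
    and "goodearl_basis D n L t G"
  shows "quotient_diff_domain D t (diff_ideal_gen D t (BC D t L G))"
proof -
  interpret commuting_ops D L t G
    using assms
    by unfold_locales (auto simp: normal_form_op_def goodearl_basis_def)
  show ?thesis
    unfolding quotient_diff_domain_def
  proof (intro conjI ballI impI)
    \<comment> \<open>Membership now means vanishing under \<open>phi\<close>: properness is
      \<open>phi 1 = 1\<close>, primality is \<open>phi_mult_eq_0\<close>.\<close>
    show "1 \<notin> diff_ideal_gen D t (BC D t L G)"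
      by (simp add: diff_ideal_gen_BC)
    show "a \<in> diff_ideal_gen D t (BC D t L G) \<or> b \<in> diff_ideal_gen D t (BC D t L G)"
      if "a \<in> polys_in t" "b \<in> polys_in t" "a * b \<in> diff_ideal_gen D t (BC D t L G)" for a b
      using that phi_mult_eq_0[of a b] by (simp add: diff_ideal_gen_BC)
  qed (rule diff_ideal_gen_closed)
qed

end
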